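(* Let $n \ge 1$ and let $A=(a_{ij}),B=(b_{ij}) \in \mathbb{R}^{n \times n}$ be such that $\max\{a_{ii}, b_{ii}\} < 0$ for all $i \in \{1,\dots,n\}$. Then every matrix in the interval hull $\mathbb{I}(A,B)$ is an $N$-matrix of the second category if and only if $I_z$ is an $N$-matrix of the second category for all $z \in \{\pm 1\}^n \setminus \{e, -e\}$.
   Context: For $A=(a_{ij}), B=(b_{ij}) \in \mathbb{R}^{n\times n}$, the interval hull is $\mathbb{I}(A,B) = \{C \in \mathbb{R}^{n\times n} : c_{ij} = t_{ij} a_{ij} + (1-t_{ij}) b_{ij},\ t_{ij} \in [0,1]\}$, where the $t_{ij}$ are chosen independently for each entry. Define the $n \times n$ matrices $(I_u)_{ij} = \max\{a_{ij},b_{ij}\}$, $(I_l)_{ij} = \min\{a_{ij},b_{ij}\}$, $I_c = \frac{A+B}{2}$, $\Delta = \frac{I_u - I_l}{2}$. For $z=(z_1,\dots,z_n) \in \{\pm 1\}^n$, let $D_z = \mathrm{diag}(z_1,\dots,z_n)$ and $I_z = I_c - D_z \Delta D_z$. The vector $e \in \mathbb{R}^n$ has all entries equal to $1$. A real $n \times n$ matrix is an $N$-matrix if all its principal minors (including the determinant) are negative. An $N$-matrix is of the first category if it has at least one positive entry; otherwise it is of the second category. *)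

theory Defs
  imports Complex_Main
    "Jordan_Normal_Form.Determinant"
    "Jordan_Normal_Form.DL_Submatrix"
begin

(* Rows and columns are indexed from 0, i.e. by {..<n}. *)

definition interval_hull :: "real mat \<Rightarrow> real mat \<Rightarrow> real mat set" where
  "interval_hull A B =
     {C \<in> carrier_mat (dim_row A) (dim_col A).
        \<exists>t :: nat \<Rightarrow> nat \<Rightarrow> real. \<forall>i < dim_row A. \<forall>j < dim_col A.
          t i j \<in> {0..1} \<and> C $$ (i,j) = t i j * A $$ (i,j) + (1 - t i j) * B $$ (i,j)}"

definition hull_upper :: "real mat \<Rightarrow> real mat \<Rightarrow> real mat" where
  "hull_upper A B = mat (dim_row A) (dim_col A) (\<lambda>(i,j). max (A $$ (i,j)) (B $$ (i,j)))"

definition hull_lower :: "real mat \<Rightarrow> real mat \<Rightarrow> real mat" where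
  "hull_lower A B = mat (dim_row A) (dim_col A) (\<lambda>(i,j). min (A $$ (i,j)) (B $$ (i,j)))"

definition hull_center :: "real mat \<Rightarrow> real mat \<Rightarrow> real mat" where
  "hull_center A B = (1/2) \<cdot>\<^sub>m (A + B)"

definition hull_radius :: "real mat \<Rightarrow> real mat \<Rightarrow> real mat" where
  "hull_radius A B = (1/2) \<cdot>\<^sub>m (hull_upper A B - hull_lower A B)"

definition diag_of_vec :: "real vec \<Rightarrow> real mat" where
  "diag_of_vec z = mat_diag (dim_vec z) (\<lambda>i. z $ i)"

definition hull_sign_mat :: "real mat \<Rightarrow> real mat \<Rightarrow> real vec \<Rightarrow> real mat" where
  "hull_sign_mat A B z = hull_center A B - diag_of_vec z * hull_radius A B * diag_of_vec z"

definition sign_vecs :: "nat \<Rightarrow> real vec set" where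
  "sign_vecs n = {z \<in> carrier_vec n. \<forall>i < n. z $ i \<in> {1, -1}}"

definition ones_vec :: "nat \<Rightarrow> real vec" where
  "ones_vec n = vec n (\<lambda>_. 1)"

(* The empty index set is excluded: its minor is 1 by convention. *)
definition N_matrix :: "real mat \<Rightarrow> bool" where
  "N_matrix A \<longleftrightarrow> square_mat A \<and>
     (\<forall>S. S \<subseteq> {..<dim_row A} \<and> S \<noteq> {} \<longrightarrow> det (submatrix A S S) < 0)"

definition N_matrix_first_category :: "real mat \<Rightarrow> bool" where
  "N_matrix_first_category A \<longleftrightarrow>
     N_matrix A \<and> (\<exists>i < dim_row A. \<exists>j < dim_col A. A $$ (i,j) > 0)"

definition N_matrix_second_category :: "real mat \<Rightarrow> bool" where
  "N_matrix_second_category A \<longleftrightarrow> N_matrix A \<and> \<not> N_matrix_first_category A"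

end

theory Submission
  imports Defs
begin

text \<open>
  A matrix with negative entries is an N-matrix iff it reverses the sign
  (\<open>x\<^sub>i (A x)\<^sub>i \<le> 0\<close> for all \<open>i\<close>) of no vector having both a
  positive and a negative entry.  If \<open>C\<close> in the interval hull reverses the sign of such an
  \<open>x\<close>, let \<open>z\<close> be the sign vector of \<open>x\<close>, which is neither \<open>e\<close> nor \<open>-e\<close>.  As
  \<open>|C - I\<^sub>c| \<le> \<Delta>\<close> entrywise, \<open>x\<^sub>i (I\<^sub>z x)\<^sub>i \<le> x\<^sub>i (C x)\<^sub>i\<close>, so \<open>I\<^sub>z\<close> reverses the sign of
  \<open>x\<close> as well.  Negativity of the off-diagonal entries of \<open>C\<close> is obtained from any \<open>z\<close> with
  \<open>z\<^sub>i \<noteq> z\<^sub>j\<close>, for which the \<open>(i,j)\<close> entry of \<open>I\<^sub>z\<close> is the upper bound.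
\<close>

section \<open>Principal minors as sums over permutations of the index set\<close>

text \<open>The Leibniz formula over the permutations of \<open>S\<close> itself: index sets need no
  renumbering, and passing to a subset of \<open>S\<close> only changes which permutations are
  summed.\<close>

definition principal_minor :: "(nat \<Rightarrow> nat \<Rightarrow> real) \<Rightarrow> nat set \<Rightarrow> real" where
  "principal_minor a S = (\<Sum>p | p permutes S. of_int (sign p) * (\<Prod>i\<in>S. a i (p i)))"

text \<open>Conjugation by \<open>h\<close> carries the permutations of \<open>{0..<k}\<close> to
  those of \<open>S\<close> and preserves signs, so the two Leibniz sums agree term by term. Rows
  and columns are renumbered alike, so \<open>h\<close> may be any enumeration.\<close>

lemma det_eq_principal_minor:
  assumes h: "bij_betw h {0..<k} S"
  shows "det (mat k k (\<lambda>(i,j). a (h i) (h j))) = principal_minor a S"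
proof -
  have hS: "h ` {0..<k} = S" and inj: "inj_on h {0..<k}"
    using h by (auto simp: bij_betw_def)
  have bij: "bij_betw (map_permutation {0..<k} h) {p. p permutes {0..<k}} {p. p permutes S}"
    using bij_betw_permutations[OF h]
    by (rule bij_betw_cong[THEN iffD1, rotated])
      (auto simp: map_permutation_def restrict_id_def hS fun_eq_iff)
  have "principal_minor a S =
      (\<Sum>p | p permutes {0..<k}. of_int (sign (map_permutation {0..<k} h p)) *
        (\<Prod>i\<in>S. a i (map_permutation {0..<k} h p i)))"
    unfolding principal_minor_def by (rule sum.reindex_bij_betw[OF bij, symmetric])
  also have "\<dots> = (\<Sum>p | p permutes {0..<k}. of_int (sign p) * (\<Prod>i = 0..<k. a (h i) (h (p i))))"
  proof (rule sum.cong[OF refl])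
    fix p assume "p \<in> {p. p permutes {0..<k}}"
    then have p: "p permutes {0..<k}" by simp
    have "(\<Prod>i\<in>S. a i (map_permutation {0..<k} h p i)) =
        (\<Prod>i\<in>{0..<k}. a (h i) (map_permutation {0..<k} h p (h i)))"
      by (rule prod.reindex_bij_betw[OF h, symmetric])
    also have "\<dots> = (\<Prod>i = 0..<k. a (h i) (h (p i)))"
      by (rule prod.cong) (auto simp: map_permutation_apply[OF inj])
    finally show "of_int (sign (map_permutation {0..<k} h p)) *
        (\<Prod>i\<in>S. a i (map_permutation {0..<k} h p i)) =
        of_int (sign p) * (\<Prod>i = 0..<k. a (h i) (h (p i)))"
      using sign_map_permutation[OF inj p] by simp
  qed
  also have "\<dots> = det (mat k k (\<lambda>(i,j). a (h i) (h j)))"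
    unfolding det_def'[OF mat_carrier]
  proof (rule sum.cong[OF refl])
    fix p assume "p \<in> {p. p permutes {0..<k}}"
    then have p: "p permutes {0..<k}" by simp
    have "p i < k" if "i < k" for i
      using permutes_in_image[OF p, of i] that by simp
    then show "of_int (sign p) * (\<Prod>i = 0..<k. a (h i) (h (p i))) =
        of_int (sign p) * (\<Prod>i = 0..<k. mat k k (\<lambda>(i,j). a (h i) (h j)) $$ (i, p i))"
      by simp
  qed
  finally show ?thesis ..
qed

lemma bij_betw_pick:
  assumes fin: "finite S"
  shows "bij_betw (pick S) {0..<card S} S"
proof -
  have "inj_on (pick S) {0..<card S}"
    by (rule linorder_inj_onI) (auto dest: pick_mono_le)
  moreover have "pick S ` {0..<card S} \<subseteq> S"
    by (auto intro: pick_in_set_le)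
  ultimately show ?thesis
    using fin by (simp add: bij_betw_def card_image card_subset_eq)
qed

lemma det_submatrix_eq_principal_minor:
  assumes "A \<in> carrier_mat n n" "S \<subseteq> {..<n}"
  shows "det (submatrix A S S) = principal_minor (\<lambda>i j. A $$ (i,j)) S"
proof -
  have "{i. i < n \<and> i \<in> S} = S" using assms(2) by auto
  then have "submatrix A S S = mat (card S) (card S) (\<lambda>(i,j). A $$ (pick S i, pick S j))"
    using assms(1) by (simp add: submatrix_def)
  then show ?thesis
    using det_eq_principal_minor[OF bij_betw_pick, of S "\<lambda>i j. A $$ (i,j)"] assms(2)
    by (simp add: finite_subset)
qed

text \<open>The criterion that a singular matrix has a nonzero kernel vector, carried along an
  enumeration \<open>h\<close> of \<open>S\<close>; vectors become functions whose values outside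
  \<open>S\<close> are irrelevant.\<close>

lemma principal_minor_eq_0_iff:
  assumes "finite S"
  shows "principal_minor a S = 0 \<longleftrightarrow>
    (\<exists>x. (\<exists>i\<in>S. x i \<noteq> 0) \<and> (\<forall>i\<in>S. (\<Sum>j\<in>S. a i j * x j) = 0))"
proof -
  define k where "k = card S"
  obtain h where h: "bij_betw h {0..<k} S"
    using ex_bij_betw_nat_finite[OF assms] k_def by auto
  define M where "M = mat k k (\<lambda>(i,j). a (h i) (h j))"
  have M: "M \<in> carrier_mat k k" by (simp add: M_def)
  have hi: "h i \<in> S" if "i < k" for i
    using h that by (auto simp: bij_betw_def)
  have hS: "\<exists>l<k. i = h l" if "i \<in> S" for i
    using h that by (auto simp: bij_betw_def)
  have mult: "(M *\<^sub>v v) $ i = (\<Sum>j\<in>S. a (h i) j * v $ (inv_into {0..<k} h j))"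
    if "v \<in> carrier_vec k" "i < k" for v i
  proof -
    have "(M *\<^sub>v v) $ i = (\<Sum>j = 0..<k. a (h i) (h j) * v $ j)"
      using that by (simp add: M_def scalar_prod_def)
    also have "\<dots> = (\<Sum>j = 0..<k. a (h i) (h j) * v $ (inv_into {0..<k} h (h j)))"
      by (rule sum.cong) (use bij_betw_inv_into_left[OF h] in auto)
    also have "\<dots> = (\<Sum>j\<in>S. a (h i) j * v $ (inv_into {0..<k} h j))"
      by (rule sum.reindex_bij_betw[OF h])
    finally show ?thesis .
  qed
  have "principal_minor a S = 0 \<longleftrightarrow> (\<exists>v. v \<in> carrier_vec k \<and> v \<noteq> 0\<^sub>v k \<and> M *\<^sub>v v = 0\<^sub>v k)"
    using det_0_iff_vec_prod_zero[OF M] det_eq_principal_minor[OF h, of a] by (simp add: M_def)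
  also have "\<dots> \<longleftrightarrow> (\<exists>x. (\<exists>i\<in>S. x i \<noteq> 0) \<and> (\<forall>i\<in>S. (\<Sum>j\<in>S. a i j * x j) = 0))"
  proof
    assume "\<exists>v. v \<in> carrier_vec k \<and> v \<noteq> 0\<^sub>v k \<and> M *\<^sub>v v = 0\<^sub>v k"
    then obtain v where v: "v \<in> carrier_vec k" "v \<noteq> 0\<^sub>v k" "M *\<^sub>v v = 0\<^sub>v k" by blast
    obtain l where l: "l < k" "v $ l \<noteq> 0"
      using v(1,2) by (auto simp: vec_eq_iff)
    define x where "x = (\<lambda>j. v $ (inv_into {0..<k} h j))"
    have "x (h l) \<noteq> 0"
      using l bij_betw_inv_into_left[OF h, of l] by (simp add: x_def)
    moreover have "(\<Sum>j\<in>S. a i j * x j) = 0" if "i \<in> S" for i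
    proof -
      from hS[OF that] obtain m where "m < k" "i = h m" by blast
      then show ?thesis using mult[OF v(1), of m] v(3) by (simp add: x_def)
    qed
    ultimately show "\<exists>x. (\<exists>i\<in>S. x i \<noteq> 0) \<and> (\<forall>i\<in>S. (\<Sum>j\<in>S. a i j * x j) = 0)"
      using hi[OF l(1)] by blast
  next
    assume "\<exists>x. (\<exists>i\<in>S. x i \<noteq> 0) \<and> (\<forall>i\<in>S. (\<Sum>j\<in>S. a i j * x j) = 0)"
    then obtain x i where x: "i \<in> S" "x i \<noteq> 0" "\<forall>i\<in>S. (\<Sum>j\<in>S. a i j * x j) = 0" by blast
    define v where "v = vec k (\<lambda>l. x (h l))"
    have v: "v \<in> carrier_vec k" by (simp add: v_def)
    have "v \<noteq> 0\<^sub>v k"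
      using hS[OF x(1)] x(2) by (auto simp: v_def vec_eq_iff)
    moreover have "M *\<^sub>v v = 0\<^sub>v k"
    proof (rule eq_vecI)
      fix l assume "l < dim_vec (0\<^sub>v k :: real vec)"
      then have l: "l < k" by simp
      have "(M *\<^sub>v v) $ l = (\<Sum>j = 0..<k. a (h l) (h j) * x (h j))"
        using l by (simp add: M_def v_def scalar_prod_def)
      also have "\<dots> = (\<Sum>j\<in>S. a (h l) j * x j)"
        by (rule sum.reindex_bij_betw[OF h])
      finally show "(M *\<^sub>v v) $ l = 0\<^sub>v k $ l"
        using x(3) hi[OF l] l by simp
    qed (simp add: M_def)
    ultimately show "\<exists>v. v \<in> carrier_vec k \<and> v \<noteq> 0\<^sub>v k \<and> M *\<^sub>v v = 0\<^sub>v k"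
      using v by blast
  qed
  finally show ?thesis .
qed

text \<open>Multiply out each product over \<open>S\<close>, with \<open>T\<close> the set of
  factors taken from \<open>a\<close>. The diagonal factors on \<open>S - T\<close> vanish unless
  \<open>p\<close> fixes \<open>S - T\<close> pointwise, and what remains are the permutations of
  \<open>T\<close>. The term \<open>T = {}\<close> is the determinant of the diagonal part.\<close>

lemma principal_minor_add_diag:
  assumes fin: "finite S"
  shows "principal_minor (\<lambda>i j. a i j + (if i = j then d i else 0)) S =
    (\<Sum>T\<in>Pow S. principal_minor a T * (\<Prod>i\<in>S - T. d i))"
proof -
  let ?e = "\<lambda>p i. if i = p i then d i else 0"
  let ?f = "\<lambda>p T. of_int (sign p) * ((\<Prod>i\<in>T. a i (p i)) * (\<Prod>i\<in>S - T. ?e p i))"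
  have "principal_minor (\<lambda>i j. a i j + (if i = j then d i else 0)) S =
      (\<Sum>p | p permutes S. \<Sum>T\<in>Pow S. ?f p T)"
    unfolding principal_minor_def by (simp add: prod_add[OF fin] sum_distrib_left)
  also have "\<dots> = (\<Sum>T\<in>Pow S. \<Sum>p | p permutes S. ?f p T)"
    by (rule sum.swap)
  also have "\<dots> = (\<Sum>T\<in>Pow S. principal_minor a T * (\<Prod>i\<in>S - T. d i))"
  proof (rule sum.cong[OF refl])
    fix T assume "T \<in> Pow S"
    then have T: "T \<subseteq> S" by simp
    have "(\<Sum>p | p permutes S. ?f p T) = (\<Sum>p | p permutes T. ?f p T)"
    proof (rule sum.mono_neutral_right)
      show "finite {p. p permutes S}" using fin by (rule finite_permutations)
      show "{p. p permutes T} \<subseteq> {p. p permutes S}" using T by (auto intro: permutes_subset)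
      show "\<forall>p\<in>{p. p permutes S} - {p. p permutes T}. ?f p T = 0"
      proof
        fix p assume p: "p \<in> {p. p permutes S} - {p. p permutes T}"
        then obtain i where "i \<in> S - T" "p i \<noteq> i"
          using permutes_superset[of p S T] by auto
        then have "(\<Prod>i\<in>S - T. ?e p i) = 0"
          using fin by (intro prod_zero) force+
        then show "?f p T = 0" by simp
      qed
    qed
    also have "\<dots> = (\<Sum>p | p permutes T. of_int (sign p) * (\<Prod>i\<in>T. a i (p i)) * (\<Prod>i\<in>S - T. d i))"
    proof (rule sum.cong[OF refl])
      fix p assume "p \<in> {p. p permutes T}"
      then have "(\<Prod>i\<in>S - T. ?e p i) = (\<Prod>i\<in>S - T. d i)"
        by (intro prod.cong) (auto simp: permutes_not_in)
      then show "?f p T = of_int (sign p) * (\<Prod>i\<in>T. a i (p i)) * (\<Prod>i\<in>S - T. d i)"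
        by simp
    qed
    also have "\<dots> = principal_minor a T * (\<Prod>i\<in>S - T. d i)"
      by (simp add: principal_minor_def sum_distrib_right)
    finally show "(\<Sum>p | p permutes S. ?f p T) = principal_minor a T * (\<Prod>i\<in>S - T. d i)" .
  qed
  finally show ?thesis .
qed

lemma principal_minor_empty [simp]: "principal_minor a {} = 1"
  by (simp add: principal_minor_def)

lemma principal_minor_singleton [simp]: "principal_minor a {i} = a i i"
  by (simp add: principal_minor_def)

lemma principal_minor_doubleton:
  assumes "i \<noteq> j"
  shows "principal_minor a {i, j} = a i i * a j j - a i j * a j i"
proof -
  have "{p. p permutes {i, j}} = {id, Transposition.transpose i j}"
    by (auto simp: permutes_doubleton_iff)
  moreover have "id \<noteq> Transposition.transpose i j"
    using assms by (metis id_apply transpose_apply_first)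
  ultimately show ?thesis
    using assms by (simp add: principal_minor_def sign_swap_id)
qed

section \<open>Sign reversal and the signs of principal minors\<close>

text \<open>Rows and sums both range over \<open>S\<close>, so this concerns the principal submatrix
  on \<open>S\<close>. The inequality is weak, so an index with \<open>x i = 0\<close> always
  complies.\<close>

definition reverses_sign :: "(nat \<Rightarrow> nat \<Rightarrow> real) \<Rightarrow> nat set \<Rightarrow> (nat \<Rightarrow> real) \<Rightarrow> bool" where
  "reverses_sign a S x \<longleftrightarrow> (\<forall>i\<in>S. x i * (\<Sum>j\<in>S. a i j * x j) \<le> 0)"

lemma sum_add_diag_mult:
  fixes a :: "nat \<Rightarrow> nat \<Rightarrow> real"
  assumes "finite S" "i \<in> S"
  shows "(\<Sum>j\<in>S. (a i j + (if i = j then d i else 0)) * x j) = (\<Sum>j\<in>S. a i j * x j) + d i * x i"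
proof -
  have "(\<Sum>j\<in>S. (if i = j then d i else 0) * x j) = (\<Sum>j\<in>S. if i = j then d i * x j else 0)"
    by (rule sum.cong) auto
  then show ?thesis
    using assms by (simp add: distrib_right sum.distrib)
qed

text \<open>One direction of the Fiedler-Ptak characterization of P-matrices, for vectors without
  zero entries. Sign reversal gives \<open>(A + D) x = 0\<close> with a diagonal
  \<open>D \<ge> 0\<close>, but the expansion of \<open>det (A + D)\<close> has only nonnegative
  terms, and the term \<open>det A\<close> is positive.\<close>

lemma positive_minors_not_reverse_sign:
  assumes fin: "finite S"
    and pos: "\<And>T. T \<subseteq> S \<Longrightarrow> principal_minor a T > 0"
    and rev: "reverses_sign a S x"
    and nz: "\<And>i. i \<in> S \<Longrightarrow> x i \<noteq> 0"
  shows "S = {}"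
proof (rule ccontr)
  assume "S \<noteq> {}"
  \<comment> \<open>Solves \<open>(A x) i + d i * x i = 0\<close>; sign reversal makes it
    nonnegative.\<close>
  define d where "d = (\<lambda>i. - (\<Sum>j\<in>S. a i j * x j) / x i)"
  have d: "d i \<ge> 0" if "i \<in> S" for i
    using rev nz[OF that] that
    by (auto simp: d_def reverses_sign_def divide_le_0_iff mult_le_0_iff)
  have "(\<Sum>j\<in>S. (a i j + (if i = j then d i else 0)) * x j) = 0" if "i \<in> S" for i
    using sum_add_diag_mult[OF fin that, of a d x] nz[OF that] by (simp add: d_def)
  then have "principal_minor (\<lambda>i j. a i j + (if i = j then d i else 0)) S = 0"
    using \<open>S \<noteq> {}\<close> nz by (auto simp: principal_minor_eq_0_iff[OF fin])
  moreover have "(\<Sum>T\<in>Pow S. principal_minor a T * (\<Prod>i\<in>S - T. d i)) > 0"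
  proof (rule sum_pos2[of _ S])
    show "0 < principal_minor a S * (\<Prod>i\<in>S - S. d i)" using pos by simp
    show "0 \<le> principal_minor a T * (\<Prod>i\<in>S - T. d i)" if "T \<in> Pow S" for T
      using pos[of T] that d by (intro mult_nonneg_nonneg prod_nonneg) (auto simp: less_imp_le)
  qed (use fin in auto)
  ultimately show False
    by (simp add: principal_minor_add_diag[OF fin])
qed

text \<open>
  Write the sign reversal as \<open>(A + D) x = 0\<close> with \<open>D \<ge> 0\<close> diagonal and expand
  \<open>det (A + D) = 0\<close> over the principal minors of \<open>A\<close>.  The only nonnegative term is
  \<open>det D\<close>, so it balances all the others, and dropping some of these shows that the proper
  principal minors of \<open>A + D\<close> are positive.  But the principal submatrix of \<open>A + D\<close> on the
  set where \<open>x > 0\<close> reverses the sign of \<open>x\<close>, since the rest of \<open>(A + D) x\<close> is nonnegative there.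
\<close>
lemma negative_minors_not_reverse_mixed_sign_aux:
  assumes fin: "finite S"
    and neg: "\<And>i j. i \<in> S \<Longrightarrow> j \<in> S \<Longrightarrow> a i j < 0"
    and minors: "\<And>T. T \<subseteq> S \<Longrightarrow> T \<noteq> {} \<Longrightarrow> principal_minor a T < 0"
    and rev: "reverses_sign a S x"
    and nz: "\<And>i. i \<in> S \<Longrightarrow> x i \<noteq> 0"
    and mixed: "\<exists>i\<in>S. x i > 0" "\<exists>i\<in>S. x i < 0"
  shows False
proof -
  define d where "d = (\<lambda>i. - (\<Sum>j\<in>S. a i j * x j) / x i)"
  define b where "b = (\<lambda>i j. a i j + (if i = j then d i else 0))"
  define c where "c = (\<lambda>T. principal_minor a T * (\<Prod>i\<in>S - T. d i))"
  have Sne: "S \<noteq> {}" using mixed by auto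
  have d0: "d i \<ge> 0" if "i \<in> S" for i
    using rev nz[OF that] that
    by (auto simp: d_def reverses_sign_def divide_le_0_iff mult_le_0_iff)
  have bx: "(\<Sum>j\<in>S. b i j * x j) = 0" if "i \<in> S" for i
    using sum_add_diag_mult[OF fin that, of a d x] nz[OF that] by (simp add: b_def d_def)
  have sum0: "(\<Sum>T\<in>Pow S. c T) = 0"
  proof -
    have "principal_minor b S = 0"
      unfolding principal_minor_eq_0_iff[OF fin] using bx Sne nz by blast
    then show ?thesis
      by (simp add: principal_minor_add_diag[OF fin] b_def c_def)
  qed
  have c_neg: "c T \<le> 0" if "T \<subseteq> S" "T \<noteq> {}" for T
    using minors[OF that] that d0 unfolding c_def
    by (intro mult_nonpos_nonneg prod_nonneg) auto
  have cS: "c S < 0" using minors[OF order.refl Sne] by (simp add: c_def)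
  \<comment> \<open>The whole sum is 0. The terms with \<open>T\<close> not inside \<open>U\<close>
    are nonpositive, and \<open>c S\<close> among them is negative, so the terms inside
    \<open>U\<close> have a positive sum.\<close>
  have partial: "(\<Sum>T\<in>Pow U. c T) > 0" if "U \<subset> S" for U
  proof -
    have "(\<Sum>T\<in>Pow S. c T) = (\<Sum>T\<in>Pow U. c T) + (\<Sum>T\<in>Pow S - Pow U. c T)"
      using fin that by (simp add: sum.subset_diff[of "Pow U" "Pow S"] Pow_mono psubset_imp_subset)
    moreover have "(\<Sum>T\<in>Pow S - Pow U. c T) < 0"
    proof -
      have "(\<Sum>T\<in>Pow S - Pow U. - c T) > 0"
        by (rule sum_pos2[of _ S]) (use fin that cS c_neg in auto)
      then show ?thesis by (simp add: sum_negf)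
    qed
    ultimately show ?thesis using sum0 by linarith
  qed
  \<comment> \<open>For \<open>U = {}\<close> only the term \<open>det D\<close> is left.\<close>
  have "0 < (\<Prod>i\<in>S. d i)"
    using partial[of "{}"] Sne by (auto simp: c_def)
  then have d_pos: "d i > 0" if "i \<in> S" for i
    using d0[OF that] that fin by (metis less_eq_real_def less_irrefl prod_zero)
  have proper: "principal_minor b U > 0" if U: "U \<subset> S" for U
  proof -
    have finU: "finite U" using U fin by (auto intro: finite_subset)
    \<comment> \<open>For \<open>T\<close> inside \<open>U\<close> the product over
      \<open>S - T\<close> splits at \<open>U\<close>, so the partial sum is
      \<open>principal_minor b U\<close> times the product of \<open>d\<close> over
      \<open>S - U\<close>.\<close>
    have "(\<Sum>T\<in>Pow U. c T) = (\<Sum>T\<in>Pow U. principal_minor a T * (\<Prod>i\<in>U - T. d i) * (\<Prod>i\<in>S - U. d i))"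
    proof (rule sum.cong[OF refl])
      fix T assume "T \<in> Pow U"
      then have "S - U \<subseteq> S - T" "(S - T) - (S - U) = U - T" using U by auto
      then have "(\<Prod>i\<in>S - T. d i) = (\<Prod>i\<in>U - T. d i) * (\<Prod>i\<in>S - U. d i)"
        using prod.subset_diff[of "S - U" "S - T" d] fin by simp
      then show "c T = principal_minor a T * (\<Prod>i\<in>U - T. d i) * (\<Prod>i\<in>S - U. d i)"
        by (simp add: c_def)
    qed
    also have "\<dots> = principal_minor b U * (\<Prod>i\<in>S - U. d i)"
      by (simp add: b_def principal_minor_add_diag[OF finU] sum_distrib_right)
    finally have "principal_minor b U * (\<Prod>i\<in>S - U. d i) > 0"
      using partial[OF U] by simp
    moreover have "(\<Prod>i\<in>S - U. d i) > 0" using d_pos by (intro prod_pos) auto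
    ultimately show ?thesis by (simp add: zero_less_mult_iff)
  qed
  define P where "P = {i\<in>S. x i > 0}"
  obtain l where "l \<in> S" "x l < 0" using mixed(2) by blast
  then have "l \<in> S - P" by (simp add: P_def)
  then have P: "P \<subset> S" by (auto simp: P_def)
  have finP: "finite P" using P fin by (auto intro: finite_subset)
  have "reverses_sign b P x"
    unfolding reverses_sign_def
  proof
    fix i assume i: "i \<in> P"
    have "(\<Sum>j\<in>S. b i j * x j) = (\<Sum>j\<in>P. b i j * x j) + (\<Sum>j\<in>S - P. b i j * x j)"
      using fin P by (simp add: sum.subset_diff[of P S] psubset_imp_subset)
    moreover have "(\<Sum>j\<in>S - P. b i j * x j) \<ge> 0"
    proof (rule sum_nonneg)
      fix j assume j: "j \<in> S - P"
      \<comment> \<open>Here \<open>i\<close> lies in \<open>P\<close> and \<open>j\<close> does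
        not, so the entry is off the diagonal and equals \<open>a i j\<close>.\<close>
      then have "b i j < 0" "x j \<le> 0" using i neg[of i j] by (auto simp: b_def P_def)
      then show "b i j * x j \<ge> 0" by (simp add: mult_nonpos_nonpos)
    qed
    ultimately have "(\<Sum>j\<in>P. b i j * x j) \<le> 0" using bx[of i] i P by auto
    then show "x i * (\<Sum>j\<in>P. b i j * x j) \<le> 0"
      using i by (simp add: P_def mult_nonneg_nonpos)
  qed
  then have "P = {}"
    using P proper nz by (intro positive_minors_not_reverse_sign[OF finP, of b x]) auto
  then show False using mixed by (auto simp: P_def)
qed

text \<open>Restriction to the support of \<open>x\<close>, where division by \<open>x i\<close> is
  possible; the dropped entries contribute nothing to the sums.\<close>

lemma negative_minors_not_reverse_mixed_sign:
  assumes fin: "finite S"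
    and neg: "\<And>i j. i \<in> S \<Longrightarrow> j \<in> S \<Longrightarrow> a i j < 0"
    and minors: "\<And>T. T \<subseteq> S \<Longrightarrow> T \<noteq> {} \<Longrightarrow> principal_minor a T < 0"
    and rev: "reverses_sign a S x"
    and mixed: "\<exists>i\<in>S. x i > 0" "\<exists>i\<in>S. x i < 0"
  shows False
proof (rule negative_minors_not_reverse_mixed_sign_aux[of "{i\<in>S. x i \<noteq> 0}" a x])
  have "(\<Sum>j\<in>{i\<in>S. x i \<noteq> 0}. a i j * x j) = (\<Sum>j\<in>S. a i j * x j)" for i
    using fin by (intro sum.mono_neutral_left) auto
  then show "reverses_sign a {i\<in>S. x i \<noteq> 0} x"
    using rev by (auto simp: reverses_sign_def)
  show "principal_minor a T < 0" if "T \<subseteq> {i\<in>S. x i \<noteq> 0}" "T \<noteq> {}" for T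
    using that by (intro minors) auto
qed (use fin neg mixed in auto)

text \<open>Induction on \<open>S\<close>. Extension of vectors by 0 passes the hypothesis on to
  \<open>S - {i}\<close>, whose minor is therefore negative. If the minor of \<open>S\<close> were
  nonnegative, raising the entry \<open>a i i\<close> would make the matrix singular, with a kernel
  vector that cannot have entries of both signs; a row other than \<open>i\<close> then gives a
  contradiction.\<close>

lemma not_reverse_mixed_sign_imp_negative_minor:
  assumes "finite S" "S \<noteq> {}"
    and "\<And>i j. i \<in> S \<Longrightarrow> j \<in> S \<Longrightarrow> a i j < 0"
    and "\<And>x. reverses_sign a S x \<Longrightarrow> \<exists>i\<in>S. x i > 0 \<Longrightarrow> \<exists>i\<in>S. x i < 0 \<Longrightarrow> False"
  shows "principal_minor a S < 0"
  using assms
proof (induction S rule: finite_psubset_induct)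
  case (psubset S)
  note fin = psubset.hyps and neg = psubset.prems(2) and norev = psubset.prems(3)
  obtain i where i: "i \<in> S" using psubset.prems(1) by blast
  show ?case
  proof (cases "S = {i}")
    case True
    then show ?thesis using neg[OF i i] by simp
  next
    case False
    then obtain k where k: "k \<in> S" "k \<noteq> i" using i by blast
    have IH: "principal_minor a (S - {i}) < 0"
    proof (rule psubset.IH)
      fix x assume rev: "reverses_sign a (S - {i}) x"
        and mixed: "\<exists>i\<in>S - {i}. x i > 0" "\<exists>i\<in>S - {i}. x i < 0"
      let ?y = "x(i := 0)"
      have "(\<Sum>j\<in>S. a l j * ?y j) = (\<Sum>j\<in>S - {i}. a l j * x j)" for l
        using fin i by (simp add: sum.remove[of S i])
      then have "reverses_sign a S ?y"
        using rev by (auto simp: reverses_sign_def)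
      moreover have "\<exists>i\<in>S. ?y i > 0" "\<exists>i\<in>S. ?y i < 0" using mixed by auto
      ultimately show False by (rule norev)
    qed (use i k neg in auto)
    show ?thesis
    proof (rule ccontr)
      assume nonneg: "\<not> principal_minor a S < 0"
      \<comment> \<open>\<open>t\<close> makes \<open>A + t E\<^sub>i\<^sub>i\<close> singular; its kernel vectors have their sign reversed by \<open>A\<close>.\<close>
      define t where "t = - principal_minor a S / principal_minor a (S - {i})"
      define d where "d = (\<lambda>j. if j = i then t else 0)"
      have t: "t \<ge> 0" using nonneg IH by (simp add: t_def divide_nonneg_neg)
      \<comment> \<open>As \<open>d\<close> vanishes off \<open>i\<close>, only those
        \<open>T\<close> survive that omit at most \<open>i\<close>.\<close>
      have "(\<Sum>T\<in>Pow S. principal_minor a T * (\<Prod>j\<in>S - T. d j)) =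
          (\<Sum>T\<in>{S, S - {i}}. principal_minor a T * (\<Prod>j\<in>S - T. d j))"
      proof (rule sum.mono_neutral_right)
        show "\<forall>T\<in>Pow S - {S, S - {i}}. principal_minor a T * (\<Prod>j\<in>S - T. d j) = 0"
        proof
          fix T assume T: "T \<in> Pow S - {S, S - {i}}"
          have "\<not> S - T \<subseteq> {i}"
          proof
            assume "S - T \<subseteq> {i}"
            then consider "S - T = {}" | "S - T = {i}" by (auto simp: subset_singleton_iff)
            then show False
            proof cases
              case 1
              then show False using T by blast
            next
              case 2
              then have "T = S - {i}" using T by blast
              then show False using T by simp
            qed
          qed
          then obtain j where "j \<in> S - T" "j \<noteq> i" by blast
          then have "(\<Prod>j\<in>S - T. d j) = 0"
            using fin by (intro prod_zero) (auto simp: d_def intro!: bexI[of _ j])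
          then show "principal_minor a T * (\<Prod>j\<in>S - T. d j) = 0" by simp
        qed
      qed (use fin in auto)
      also have "\<dots> = principal_minor a S + principal_minor a (S - {i}) * t"
      proof -
        have "S - (S - {i}) = {i}" "S \<noteq> S - {i}" using i by auto
        then show ?thesis by (simp add: d_def)
      qed
      also have "\<dots> = 0" using IH by (simp add: t_def)
      finally have "principal_minor (\<lambda>i j. a i j + (if i = j then d i else 0)) S = 0"
        by (simp add: principal_minor_add_diag[OF fin])
      then obtain x where x: "\<exists>j\<in>S. x j \<noteq> 0"
        and ker: "\<And>l. l \<in> S \<Longrightarrow> (\<Sum>j\<in>S. a l j * x j) + d l * x l = 0"
        using sum_add_diag_mult[OF fin, of _ a d]
        by (auto simp: principal_minor_eq_0_iff[OF fin])
      have ax: "(\<Sum>j\<in>S. a l j * x j) = - (d l * x l)" if "l \<in> S" for l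
        using ker[OF that] by linarith
      have "reverses_sign a S x"
        using t by (auto simp: reverses_sign_def ax d_def mult.left_commute[of _ t])
      then consider "\<forall>j\<in>S. x j \<ge> 0" | "\<forall>j\<in>S. x j \<le> 0"
        using norev[of x] by (meson not_le)
      \<comment> \<open>Row \<open>k\<close> has negative entries and \<open>x\<close> is nonzero of
        one sign, so nothing cancels. But \<open>d k = 0\<close>, so the kernel equation makes this
        sum 0.\<close>
      then have "(\<Sum>j\<in>S. a k j * x j) \<noteq> 0"
      proof cases
        case 1
        obtain m where "m \<in> S" "x m \<noteq> 0" using x by blast
        then have "(\<Sum>j\<in>S. - (a k j * x j)) > 0"
          using fin 1 neg[OF k(1)] 
          by (intro sum_pos2[of _ m]) (auto simp: mult_le_0_iff mult_less_0_iff less_imp_le less_le)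
        then show ?thesis by (simp add: sum_negf)
      next
        case 2
        obtain m where "m \<in> S" "x m \<noteq> 0" using x by blast
        then have "(\<Sum>j\<in>S. a k j * x j) > 0"
          using fin 2 neg[OF k(1)]
          by (intro sum_pos2[of _ m]) (auto simp: zero_le_mult_iff zero_less_mult_iff less_imp_le less_le)
        then show ?thesis by simp
      qed
      then show False using ax[OF k(1)] k(2) by (simp add: d_def)
    qed
  qed
qed

section \<open>N-matrices of the second category\<close>

text \<open>Having no positive entry gives only \<open>\<le> 0\<close>. Strictness comes from the
  minors of order 1 on the diagonal and of order 2 off it: a zero at \<open>(i,j)\<close> would
  leave the positive product of two diagonal entries.\<close>

lemma N_matrix_second_categoryD:
  assumes A: "A \<in> carrier_mat n n" and N: "N_matrix_second_category A"
  shows "\<And>T. T \<subseteq> {..<n} \<Longrightarrow> T \<noteq> {} \<Longrightarrow> principal_minor (\<lambda>i j. A $$ (i,j)) T < 0"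
    and "\<And>i j. i < n \<Longrightarrow> j < n \<Longrightarrow> A $$ (i,j) < 0"
proof -
  show minors: "principal_minor (\<lambda>i j. A $$ (i,j)) T < 0" if "T \<subseteq> {..<n}" "T \<noteq> {}" for T
  proof -
    have "det (submatrix A T T) < 0"
      using N A that unfolding N_matrix_second_category_def N_matrix_def by blast
    then show ?thesis
      by (simp add: det_submatrix_eq_principal_minor[OF A that(1)])
  qed
  fix i j assume ij: "i < n" "j < n"
  have nonpos: "A $$ (k,l) \<le> 0" if "k < n" "l < n" for k l
    using N A that
    unfolding N_matrix_second_category_def N_matrix_first_category_def not_less[symmetric]
    by blast
  have diag: "A $$ (k,k) < 0" if "k < n" for k
    using minors[of "{k}"] that by simp
  show "A $$ (i,j) < 0"
  proof (cases "i = j")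
    case False
    have "A $$ (i,i) * A $$ (j,j) - A $$ (i,j) * A $$ (j,i) < 0"
      using minors[of "{i,j}"] ij False by (simp add: principal_minor_doubleton)
    moreover have "A $$ (i,i) * A $$ (j,j) > 0"
      using diag ij by (simp add: mult_neg_neg)
    ultimately have "A $$ (i,j) \<noteq> 0" by auto
    then show ?thesis using nonpos[OF ij] by simp
  qed (use diag ij in simp)
qed

lemma N_matrix_second_categoryI:
  assumes A: "A \<in> carrier_mat n n"
    and "\<And>T. T \<subseteq> {..<n} \<Longrightarrow> T \<noteq> {} \<Longrightarrow> principal_minor (\<lambda>i j. A $$ (i,j)) T < 0"
    and "\<And>i j. i < n \<Longrightarrow> j < n \<Longrightarrow> A $$ (i,j) < 0"
  shows "N_matrix_second_category A"
proof -
  have "N_matrix A"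
    using A assms(2) by (auto simp: N_matrix_def det_submatrix_eq_principal_minor[OF A])
  moreover have "\<not> A $$ (i,j) > 0" if "i < n" "j < n" for i j
    using assms(3)[OF that] by simp
  ultimately show ?thesis
    using A by (auto simp: N_matrix_second_category_def N_matrix_first_category_def)
qed

lemma reverses_sign_extend_by_0:
  assumes "finite S" "T \<subseteq> S" "reverses_sign a T x"
  shows "reverses_sign a S (\<lambda>i. if i \<in> T then x i else 0)"
proof -
  have "(\<Sum>j\<in>S. a i j * (if j \<in> T then x j else 0)) = (\<Sum>j\<in>T. a i j * x j)" for i
    using assms(1,2) by (intro sum.mono_neutral_cong_right) auto
  then show ?thesis
    using assms(3) by (simp add: reverses_sign_def)
qed

text \<open>A vector reversed by a principal submatrix extends by 0 to one reversed by the whole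
  matrix, so the condition on \<open>{..<n}\<close> controls all principal minors.\<close>

lemma N_matrix_second_category_iff_not_reverse_mixed_sign:
  assumes A: "A \<in> carrier_mat n n"
    and neg: "\<And>i j. i < n \<Longrightarrow> j < n \<Longrightarrow> A $$ (i,j) < 0"
  shows "N_matrix_second_category A \<longleftrightarrow>
    (\<forall>x. reverses_sign (\<lambda>i j. A $$ (i,j)) {..<n} x \<longrightarrow>
      (\<forall>i<n. x i \<ge> 0) \<or> (\<forall>i<n. x i \<le> 0))"
proof
  assume N: "N_matrix_second_category A"
  show "\<forall>x. reverses_sign (\<lambda>i j. A $$ (i,j)) {..<n} x \<longrightarrow>
      (\<forall>i<n. x i \<ge> 0) \<or> (\<forall>i<n. x i \<le> 0)"
  proof (intro allI impI, rule ccontr)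
    fix x assume "reverses_sign (\<lambda>i j. A $$ (i,j)) {..<n} x"
      "\<not> ((\<forall>i<n. x i \<ge> 0) \<or> (\<forall>i<n. x i \<le> 0))"
    then show False
      using N_matrix_second_categoryD[OF A N]
      by (intro negative_minors_not_reverse_mixed_sign[of "{..<n}" "\<lambda>i j. A $$ (i,j)" x])
        (auto simp: not_le)
  qed
next
  assume unisigned: "\<forall>x. reverses_sign (\<lambda>i j. A $$ (i,j)) {..<n} x \<longrightarrow>
      (\<forall>i<n. x i \<ge> 0) \<or> (\<forall>i<n. x i \<le> 0)"
  show "N_matrix_second_category A"
  proof (rule N_matrix_second_categoryI[OF A _ neg])
    fix T assume T: "T \<subseteq> {..<n}" "T \<noteq> {}"
    show "principal_minor (\<lambda>i j. A $$ (i,j)) T < 0"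
    proof (rule not_reverse_mixed_sign_imp_negative_minor)
      show "finite T" using T by (auto intro: finite_subset)
      fix x assume rev: "reverses_sign (\<lambda>i j. A $$ (i,j)) T x"
        and mixed: "\<exists>i\<in>T. x i > 0" "\<exists>i\<in>T. x i < 0"
      show False
        using unisigned[rule_format, OF reverses_sign_extend_by_0[OF _ T(1) rev]] mixed T(1)
        by (auto simp: subset_iff not_le[symmetric])
    qed (use T neg in auto)
  qed
qed

section \<open>Entries of \<open>I_z\<close> and of the matrices in the hull\<close>

lemma hull_sign_mat_carrier:
  assumes "A \<in> carrier_mat n n" "B \<in> carrier_mat n n" "z \<in> carrier_vec n"
  shows "hull_sign_mat A B z \<in> carrier_mat n n"
  using assms
  by (auto simp: hull_sign_mat_def hull_center_def hull_radius_def hull_upper_def hull_lower_def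
      diag_of_vec_def mat_diag_def)

lemma hull_sign_mat_index:
  assumes "A \<in> carrier_mat n n" "B \<in> carrier_mat n n" "z \<in> carrier_vec n" "i < n" "j < n"
  shows "hull_sign_mat A B z $$ (i,j) =
    (A $$ (i,j) + B $$ (i,j)) / 2 - z $ i * z $ j * (\<bar>A $$ (i,j) - B $$ (i,j)\<bar> / 2)"
proof -
  have R: "hull_radius A B \<in> carrier_mat n n"
    using assms by (auto simp: hull_radius_def hull_upper_def hull_lower_def)
  have "diag_of_vec z * hull_radius A B * diag_of_vec z =
      mat n n (\<lambda>(i,j). z $ i * hull_radius A B $$ (i,j) * z $ j)"
    using assms R
    by (auto simp: diag_of_vec_def mat_diag_mult_left[OF R] mat_diag_mult_right[of _ n n])
  moreover have "hull_radius A B $$ (i,j) = \<bar>A $$ (i,j) - B $$ (i,j)\<bar> / 2"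
    using assms by (auto simp: hull_radius_def hull_upper_def hull_lower_def max_def min_def)
  ultimately show ?thesis
    using assms by (simp add: hull_sign_mat_def hull_center_def)
qed

lemma hull_sign_mat_in_interval_hull:
  assumes A: "A \<in> carrier_mat n n" and B: "B \<in> carrier_mat n n" and z: "z \<in> sign_vecs n"
  shows "hull_sign_mat A B z \<in> interval_hull A B"
proof -
  have zc: "z \<in> carrier_vec n" and z1: "\<And>i. i < n \<Longrightarrow> z $ i = 1 \<or> z $ i = -1"
    using z by (auto simp: sign_vecs_def)
  \<comment> \<open>From \<open>\<bar>a - b\<bar> = sgn (a - b) * (a - b)\<close>: this is the
    coefficient of the entry of \<open>A\<close>. It is 0 or 1, or 1/2 where the entries of
    \<open>A\<close> and \<open>B\<close> agree.\<close>
  define t where "t = (\<lambda>i j. (1 - z $ i * z $ j * sgn (A $$ (i,j) - B $$ (i,j))) / 2)"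
  have "t i j \<in> {0..1} \<and>
      hull_sign_mat A B z $$ (i,j) = t i j * A $$ (i,j) + (1 - t i j) * B $$ (i,j)"
    if "i < n" "j < n" for i j
    using z1[OF that(1)] z1[OF that(2)]
    by (auto simp: t_def hull_sign_mat_index[OF A B zc that] sgn_if abs_if field_simps)
  then show ?thesis
    using A B hull_sign_mat_carrier[OF A B zc] by (auto simp: interval_hull_def)
qed

lemma interval_hull_index:
  assumes "A \<in> carrier_mat n n" "C \<in> interval_hull A B" "i < n" "j < n"
  shows "C $$ (i,j) \<le> max (A $$ (i,j)) (B $$ (i,j))"
    and "\<bar>C $$ (i,j) - (A $$ (i,j) + B $$ (i,j)) / 2\<bar> \<le> \<bar>A $$ (i,j) - B $$ (i,j)\<bar> / 2"
proof -
  obtain t :: "nat \<Rightarrow> nat \<Rightarrow> real" where "\<forall>i < dim_row A. \<forall>j < dim_col A.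
      t i j \<in> {0..1} \<and> C $$ (i,j) = t i j * A $$ (i,j) + (1 - t i j) * B $$ (i,j)"
    using assms(2) unfolding interval_hull_def by blast
  moreover have "i < dim_row A" "j < dim_col A" using assms by auto
  ultimately obtain s where s: "0 \<le> s" "s \<le> 1"
    and C: "C $$ (i,j) = s * A $$ (i,j) + (1 - s) * B $$ (i,j)"
    by (meson atLeastAtMost_iff)
  show "C $$ (i,j) \<le> max (A $$ (i,j)) (B $$ (i,j))"
    unfolding C using s by (intro convex_bound_le) auto
  have "C $$ (i,j) - (A $$ (i,j) + B $$ (i,j)) / 2 = (s - 1/2) * (A $$ (i,j) - B $$ (i,j))"
    by (simp add: C field_simps)
  moreover have "\<bar>s - 1/2\<bar> \<le> 1/2" using s by (auto simp: abs_if)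
  then have "\<bar>s - 1/2\<bar> * \<bar>A $$ (i,j) - B $$ (i,j)\<bar> \<le> 1/2 * \<bar>A $$ (i,j) - B $$ (i,j)\<bar>"
    by (rule mult_right_mono) simp
  ultimately show "\<bar>C $$ (i,j) - (A $$ (i,j) + B $$ (i,j)) / 2\<bar> \<le> \<bar>A $$ (i,j) - B $$ (i,j)\<bar> / 2"
    by (simp add: abs_mult)
qed

section \<open>Reduction of the hull to sign vectors taking both values\<close>

lemma mixed_sign_vec_in:
  assumes "\<And>i. i < n \<Longrightarrow> z i = 1 \<or> z i = (-1 :: real)"
    and "i < n" "z i = 1" "j < n" "z j = -1"
  shows "vec n z \<in> sign_vecs n - {ones_vec n, - ones_vec n}"
proof -
  have "vec n z \<noteq> ones_vec n" "vec n z \<noteq> - ones_vec n"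
    using assms(2-) by (auto simp: ones_vec_def vec_eq_iff)
  then show ?thesis using assms(1) by (auto simp: sign_vecs_def)
qed

theorem theorem3p7:
  fixes n :: nat and A B :: "real mat"
  assumes "n \<ge> 1"
    and "A \<in> carrier_mat n n"
    and "B \<in> carrier_mat n n"
    and "\<forall>i < n. max (A $$ (i,i)) (B $$ (i,i)) < 0"
  shows "(\<forall>C \<in> interval_hull A B. N_matrix_second_category C) \<longleftrightarrow>
         (\<forall>z \<in> sign_vecs n - {ones_vec n, - ones_vec n}.
            N_matrix_second_category (hull_sign_mat A B z))"
proof
  assume "\<forall>C \<in> interval_hull A B. N_matrix_second_category C"
  then show "\<forall>z \<in> sign_vecs n - {ones_vec n, - ones_vec n}.
      N_matrix_second_category (hull_sign_mat A B z)"
    using hull_sign_mat_in_interval_hull[OF assms(2,3)] by blast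
next
  assume Iz: "\<forall>z \<in> sign_vecs n - {ones_vec n, - ones_vec n}.
      N_matrix_second_category (hull_sign_mat A B z)"
  show "\<forall>C \<in> interval_hull A B. N_matrix_second_category C"
  proof
    fix C assume C: "C \<in> interval_hull A B"
    have Cc: "C \<in> carrier_mat n n" using C assms(2) by (auto simp: interval_hull_def)
    have upper_neg: "max (A $$ (i,j)) (B $$ (i,j)) < 0" if ij: "i < n" "j < n" for i j
    proof (cases "i = j")
      case False
      define z where "z = vec n (\<lambda>k. if k = i then 1 else (-1 :: real))"
      have z: "z \<in> sign_vecs n - {ones_vec n, - ones_vec n}"
        unfolding z_def by (rule mixed_sign_vec_in[of _ _ i j]) (use ij False in auto)
      then have zc: "z \<in> carrier_vec n" by (simp add: z_def)
      have "hull_sign_mat A B z $$ (i,j) < 0"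
        using N_matrix_second_categoryD(2)[OF hull_sign_mat_carrier[OF assms(2,3) zc]] Iz z ij
        by blast
      moreover have "hull_sign_mat A B z $$ (i,j) = max (A $$ (i,j)) (B $$ (i,j))"
        using ij False
        unfolding hull_sign_mat_index[OF assms(2,3) zc ij]
        by (auto simp: z_def max_def abs_if field_simps)
      ultimately show ?thesis by simp
    qed (use assms(4) ij in auto)
    have neg: "C $$ (i,j) < 0" if "i < n" "j < n" for i j
      using interval_hull_index(1)[OF assms(2) C that] upper_neg[OF that] by linarith
    have "(\<forall>i<n. x i \<ge> 0) \<or> (\<forall>i<n. x i \<le> 0)"
      if rev: "reverses_sign (\<lambda>i j. C $$ (i,j)) {..<n} x" for x
    proof (rule ccontr)
      assume mixed: "\<not> ((\<forall>i<n. x i \<ge> 0) \<or> (\<forall>i<n. x i \<le> 0))"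
      \<comment> \<open>Zeros of \<open>x\<close> may get either sign; what counts is
        \<open>z $ i * x i = \<bar>x i\<bar>\<close>.\<close>
      define z where "z = vec n (\<lambda>i. if x i < 0 then (-1 :: real) else 1)"
      obtain k l where kl: "k < n" "x k > 0" "l < n" "x l < 0"
        using mixed by (auto simp: not_le)
      have z: "z \<in> sign_vecs n - {ones_vec n, - ones_vec n}"
        unfolding z_def by (rule mixed_sign_vec_in[of _ _ k l]) (use kl in auto)
      then have zc: "z \<in> carrier_vec n" by (simp add: z_def)
      define H where "H = hull_sign_mat A B z"
      have Hc: "H \<in> carrier_mat n n"
        unfolding H_def by (rule hull_sign_mat_carrier[OF assms(2,3) zc])
      have HN: "N_matrix_second_category H" using Iz z by (simp add: H_def)
      \<comment> \<open>The left side is the least value of the right side over the hull: the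
        deviation of \<open>C\<close> from the center is bounded by the radius, and \<open>z\<close>
        gives that deviation the sign opposite to \<open>x i * x j\<close>.\<close>
      have entry: "x i * (H $$ (i,j) * x j) \<le> x i * (C $$ (i,j) * x j)" if ij: "i < n" "j < n" for i j
      proof -
        let ?c = "(A $$ (i,j) + B $$ (i,j)) / 2" and ?r = "\<bar>A $$ (i,j) - B $$ (i,j)\<bar> / 2"
        have zx: "z $ i * x i = \<bar>x i\<bar>" "z $ j * x j = \<bar>x j\<bar>"
          using ij by (auto simp: z_def)
        have "x i * (H $$ (i,j) * x j) = x i * ?c * x j - (z $ i * x i) * (z $ j * x j) * ?r"
          by (simp add: H_def hull_sign_mat_index[OF assms(2,3) zc ij] algebra_simps)
        then have H: "x i * (H $$ (i,j) * x j) = x i * ?c * x j - \<bar>x i * x j\<bar> * ?r"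
          by (simp add: zx abs_mult)
        have "\<bar>x i * x j * (C $$ (i,j) - ?c)\<bar> \<le> \<bar>x i * x j\<bar> * ?r"
          unfolding abs_mult[of "x i * x j"]
          by (rule mult_left_mono[OF interval_hull_index(2)[OF assms(2) C ij]]) simp
        then have "- (\<bar>x i * x j\<bar> * ?r) \<le> x i * x j * (C $$ (i,j) - ?c)" by linarith
        then show ?thesis unfolding H by (simp add: algebra_simps)
      qed
      have "reverses_sign (\<lambda>i j. H $$ (i,j)) {..<n} x"
        unfolding reverses_sign_def
      proof
        fix i assume i: "i \<in> {..<n}"
        have "x i * (\<Sum>j<n. H $$ (i,j) * x j) \<le> x i * (\<Sum>j<n. C $$ (i,j) * x j)"
          unfolding sum_distrib_left using entry i by (intro sum_mono) auto
        also have "\<dots> \<le> 0" using rev i by (auto simp: reverses_sign_def)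
        finally show "x i * (\<Sum>j<n. H $$ (i,j) * x j) \<le> 0" .
      qed
      then show False
        using N_matrix_second_category_iff_not_reverse_mixed_sign[OF Hc
            N_matrix_second_categoryD(2)[OF Hc HN]] HN mixed by blast
    qed
    then show "N_matrix_second_category C"
      using N_matrix_second_category_iff_not_reverse_mixed_sign[OF Cc neg] by blast
  qed
qed

end
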